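(* Let $d\ge 1$ be an integer, let $\alpha>-1$, $\mu>-1/2$, $\theta>0$ be real, and let $\{\beta_n\}_{n=0}^\infty$ be an increasing sequence of real numbers with $\beta_0>-1$. Then the Müntz ball polynomials $\mathcal{S}_{k,\ell,n}^{\alpha,\mu,\theta}(\bm{x};\{\beta_n\})$ are mutually orthogonal on $\mathbb{B}^d$ with respect to the weight function $\|\bm{x}\|^{2\theta+2\mu-2}(1-\|\bm{x}\|^{2\theta})^{\alpha}$; namely, for all $k,j\in\mathbb{N}_0$ and all $(\ell,n),(\iota,m)\in\Upsilon_\infty^d$, $$\int_{\mathbb{B}^d}\mathcal{S}_{k,\ell,n}^{\alpha,\mu,\theta}(\bm{x};\{\beta_n\})\,\mathcal{S}_{j,\iota,m}^{\alpha,\mu,\theta}(\bm{x};\{\beta_n\})\,\|\bm{x}\|^{2\theta+2\mu-2}(1-\|\bm{x}\|^{2\theta})^{\alpha}\,\mathrm{d}\bm{x}=\frac{\Gamma(k+\alpha+1)\,\Gamma(k+\beta_n+1)}{2\theta(2k+\alpha+\beta_n+1)\,\Gamma(k+1)\,\Gamma(k+\alpha+\beta_n+1)}\,\delta_{kj}\,\delta_{nm}\,\delta_{\ell\iota}.$$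
   Context: Notation: $\mathbb{N}_0=\{0,1,2,\dots\}$; $\|\cdot\|$ is the Euclidean norm on $\mathbb{R}^d$; $\mathbb{B}^d=\{\bm{x}\in\mathbb{R}^d:\|\bm{x}\|\le 1\}$; $\mathbb{S}^{d-1}$ is the unit sphere with surface measure $\mathrm{d}\sigma$ (for $d=1$, counting measure on $\{\pm1\}$); $\hat{\bm{x}}=\bm{x}/\|\bm{x}\|$ for $\bm{x}\ne \bm{0}$. Spherical harmonics: $\mathcal{H}_n^d$ is the space of real harmonic homogeneous polynomials of degree $n$ in $d$ variables, and $a_n^d=\dim\mathcal{H}_n^d$. For each $n$, $\{Y_\ell^n:1\le\ell\le a_n^d\}$ is a fixed basis of $\mathcal{H}_n^d$ (restricted to the sphere), normalised so that $\int_{\mathbb{S}^{d-1}}Y_\ell^nY_\iota^m\,\mathrm{d}\sigma=\delta_{nm}\delta_{\ell\iota}$. The index set is $\Upsilon_\infty^d=\{(\ell,n):n\in\mathbb{N}_0,\ 1\le\ell\le a_n^d\}$. Jacobi polynomials (Szegő normalisation): $P_k^{(\alpha,\beta)}(x)=\sum_{i=0}^{k}\frac{(k+\alpha+\beta+1)_i(\alpha+i+1)_{k-i}}{i!\,(k-i)!}\left(\frac{x-1}{2}\right)^i$, where $(a)_i=a(a+1)\cdots(a+i-1)$. Müntz ball polynomials: for $k\in\mathbb{N}_0$ and $(\ell,n)\in\Upsilon_\infty^d$, $$\mathcal{S}_{k,\ell,n}^{\alpha,\mu,\theta}(\bm{x};\{\beta_n\})=P_k^{(\alpha,\beta_n)}(2\|\bm{x}\|^{2\theta}-1)\,\|\bm{x}\|^{\theta\beta_n+1-\frac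 d2-\mu}\,Y_\ell^n(\hat{\bm{x}}),\qquad \bm{x}\in\mathbb{B}^d.$$ Convention: when $k=0$, the product $(\alpha+\beta_n+1)\Gamma(\alpha+\beta_n+1)$ in the denominator is read as $\Gamma(\alpha+\beta_n+2)$ (relevant only if $\alpha+\beta_n+1=0$). *)

theory Defs
  imports "HOL-Analysis.Analysis" "HOL-Library.Function_Algebras"
begin

(* There is no real_vector instance for functions in the library, so span, independent and dim
   are taken from this interpretation, with additive structure from Function_Algebras. *)
interpretation real_fun: vector_space "\<lambda>(c::real) (f::'a \<Rightarrow> real) x. c * f x"
  by unfold_locales (auto simp: fun_eq_iff algebra_simps)

definition homogeneous_polys :: "nat \<Rightarrow> (real^'d \<Rightarrow> real) set" where
  "homogeneous_polys n =
     real_fun.span {\<lambda>x. \<Prod>i\<in>UNIV. (x $ i) ^ e i | e :: 'd::finite \<Rightarrow> nat. (\<Sum>i\<in>UNIV. e i) = n}"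

definition laplacian :: "(real^'d::finite \<Rightarrow> real) \<Rightarrow> real^'d \<Rightarrow> real" where
  "laplacian f x = (\<Sum>i\<in>UNIV. (deriv ^^ 2) (\<lambda>t. f (x + t *\<^sub>R axis i 1)) 0)"

definition harmonic_polys :: "nat \<Rightarrow> (real^'d::finite \<Rightarrow> real) set" where
  "harmonic_polys n = {p \<in> homogeneous_polys n. \<forall>x. laplacian p x = 0}"

definition harmonic_dim :: "'d::finite itself \<Rightarrow> nat \<Rightarrow> nat" where
  "harmonic_dim _ n = real_fun.dim (harmonic_polys n :: (real^'d \<Rightarrow> real) set)"

definition harmonic_index :: "'d::finite itself \<Rightarrow> (nat \<times> nat) set" where
  "harmonic_index D = {(l, n). 1 \<le> l \<and> l \<le> harmonic_dim D n}"

(* Surface measure on the unit sphere: the measure of a Borel set A is d times the volume of the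
   cone {r u | u in A, 0 < r <= 1}. For d = 1 this is counting measure on {-1, 1}. *)
definition surface_measure :: "(real^'d::finite) measure" where
  "surface_measure =
     scale_measure (of_nat CARD('d))
       (distr (restrict_space lborel (cball 0 1 - {0})) (restrict_space borel (sphere 0 1)) sgn)"

lemma emeasure_surface_measure:
  fixes A :: "(real^'d::finite) set"
  assumes A: "A \<in> sets borel" "A \<subseteq> sphere 0 1"
  shows "emeasure surface_measure A =
           of_nat CARD('d) * emeasure lborel {r *\<^sub>R u | r u. 0 < r \<and> r \<le> 1 \<and> u \<in> A}"
proof -
  let ?C = "cball 0 1 - {0} :: (real^'d) set"
  have C: "?C \<in> sets borel" by simp
  have sgn: "sgn \<in> restrict_space lborel ?C \<rightarrow>\<^sub>M restrict_space borel (sphere 0 1)"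
  proof (rule measurable_restrict_space2)
    show "sgn \<in> space (restrict_space lborel ?C) \<rightarrow> sphere 0 1"
      by (auto simp: norm_sgn space_restrict_space)
    have "(sgn :: real^'d \<Rightarrow> real^'d) \<in> borel_measurable borel"
      unfolding sgn_div_norm by measurable
    then show "sgn \<in> borel_measurable (restrict_space lborel ?C)"
      by (simp add: measurable_restrict_space1)
  qed
  have A': "A \<in> sets (restrict_space borel (sphere 0 1))"
    using A by (auto simp: sets_restrict_space_iff)
  have eq: "sgn -` A \<inter> ?C = {r *\<^sub>R u | r u. 0 < r \<and> r \<le> 1 \<and> u \<in> A}"
  proof (intro set_eqI iffI)
    fix x :: "real^'d" assume "x \<in> sgn -` A \<inter> ?C"
    then have x: "sgn x \<in> A" "norm x \<le> 1" "x \<noteq> 0" by auto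
    then have "x = norm x *\<^sub>R sgn x" by (simp add: sgn_div_norm)
    then show "x \<in> {r *\<^sub>R u | r u. 0 < r \<and> r \<le> 1 \<and> u \<in> A}"
      using x by (intro CollectI exI[of _ "norm x"] exI[of _ "sgn x"]) auto
  next
    fix x assume "x \<in> {r *\<^sub>R u | r u. 0 < r \<and> r \<le> 1 \<and> u \<in> A}"
    then obtain r :: real and u :: "real^'d"
      where x: "x = r *\<^sub>R u" "0 < r" "r \<le> 1" "u \<in> A" by blast
    moreover from this have "norm u = 1" using A(2) by auto
    ultimately show "x \<in> sgn -` A \<inter> ?C" by (auto simp: sgn_div_norm)
  qed
  have "emeasure (restrict_space lborel ?C) (sgn -` A \<inter> ?C) = emeasure lborel (sgn -` A \<inter> ?C)"
    by (rule emeasure_restrict_space) auto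
  then show ?thesis
    unfolding surface_measure_def
    by (simp add: emeasure_distr[OF sgn A'] space_restrict_space eq)
qed

definition orthonormal_harmonic_basis :: "(nat \<Rightarrow> nat \<Rightarrow> real^'d::finite \<Rightarrow> real) \<Rightarrow> bool" where
  "orthonormal_harmonic_basis Y \<longleftrightarrow>
     (\<forall>n. let I = {1..harmonic_dim TYPE('d) n} in
        inj_on (\<lambda>l. Y l n) I \<and>
        real_fun.independent ((\<lambda>l. Y l n) ` I) \<and>
        real_fun.span ((\<lambda>l. Y l n) ` I) = harmonic_polys n) \<and>
     (\<forall>(l, n) \<in> harmonic_index TYPE('d). \<forall>(i, m) \<in> harmonic_index TYPE('d).
        (LINT x|surface_measure. Y l n x * Y i m x) = (if n = m \<and> l = i then 1 else 0))"

definition jacobi_poly :: "nat \<Rightarrow> real \<Rightarrow> real \<Rightarrow> real \<Rightarrow> real" where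
  "jacobi_poly k a b x =
     (\<Sum>i=0..k. pochhammer (real k + a + b + 1) i * pochhammer (a + real i + 1) (k - i) /
        (fact i * fact (k - i)) * ((x - 1) / 2) ^ i)"

(* The value at x = 0, where sgn 0 = 0, is irrelevant: it is a null set. *)
definition muntz_ball_poly ::
  "(nat \<Rightarrow> nat \<Rightarrow> real^'d::finite \<Rightarrow> real) \<Rightarrow> real \<Rightarrow> real \<Rightarrow> real \<Rightarrow> (nat \<Rightarrow> real) \<Rightarrow>
   nat \<Rightarrow> nat \<Rightarrow> nat \<Rightarrow> real^'d \<Rightarrow> real" where
  "muntz_ball_poly Y \<alpha> \<mu> \<theta> \<beta> k l n x =
     jacobi_poly k \<alpha> (\<beta> n) (2 * norm x powr (2 * \<theta>) - 1) *
     norm x powr (\<theta> * \<beta> n + 1 - real CARD('d) / 2 - \<mu>) * Y l n (sgn x)"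

definition ball_weight :: "real \<Rightarrow> real \<Rightarrow> real \<Rightarrow> real^'d::finite \<Rightarrow> real" where
  "ball_weight \<alpha> \<mu> \<theta> x =
     norm x powr (2 * \<theta> + 2 * \<mu> - 2) * (1 - norm x powr (2 * \<theta>)) powr \<alpha>"

(* The factor (2k + a + b + 1) Gamma(k + a + b + 1); for k = 0 it is read as Gamma(a + b + 2),
   which differs from the product only when a + b + 1 = 0, where Gamma has a pole. *)
definition norm_factor :: "nat \<Rightarrow> real \<Rightarrow> real \<Rightarrow> real" where
  "norm_factor k a b =
     (if k = 0 then Gamma (a + b + 2)
      else (2 * real k + a + b + 1) * Gamma (real k + a + b + 1))"

end

theory Submission imports Defs begin

text \<open>
  The map \<open>x \<mapsto> (\<parallel>x\<parallel>\<^sup>2\<^sup>\<theta>, x / \<parallel>x\<parallel>)\<close> carries Lebesgue measure on the punctured ball to a product measure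
  with radial density proportional to \<open>t powr (d / (2 * \<theta>) - 1)\<close>. In these coordinates the
  integral is \<open>1 / (2 * \<theta>)\<close> times the product of a Jacobi integral over \<open>[0, 1]\<close> with weight
  \<open>t powr ((\<beta> n + \<beta> m) / 2) * (1 - t) powr \<alpha>\<close> and the integral of the two harmonics over the sphere.
  The latter vanishes unless \<open>n = m\<close>, so Jacobi orthogonality is only needed with equal parameters.
  It holds because, by Chu-Vandermonde, the \<open>m\<close>-th moment of the \<open>k\<close>-th polynomial is a multiple of
  \<open>pochhammer (m + 1 - k) k\<close>, which vanishes for \<open>m < k\<close>.
\<close>

section \<open>Moments and orthogonality of Jacobi polynomials on [0, 1]\<close>

text \<open>Reflecting the second Pochhammer symbol absorbs the alternating sign and makes its base
  independent of \<open>i\<close>. The sum is then the binomial theorem for rising factorials, and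
  one more reflection gives the stated value.\<close>

lemma chu_vandermonde:
  fixes x y :: "'a::field_char_0"
  shows "(\<Sum>i\<le>k. (-1) ^ i * of_nat (k choose i) * pochhammer x i * pochhammer (y + of_nat i) (k - i))
       = pochhammer (y - x) k"
proof -
  \<comment> \<open>The factors run from \<open>y + i\<close> to \<open>y + k - 1\<close>; negated
    and read backwards they start at \<open>1 - y - k\<close> for every \<open>i\<close>.\<close>
  have reflect: "pochhammer (y + of_nat i) (k - i) = (-1) ^ (k - i) * pochhammer (1 - y - of_nat k) (k - i)"
    if "i \<le> k" for i
    using pochhammer_minus[of "y + of_nat k - 1" "k - i"] that
    by (simp add: of_nat_diff algebra_simps flip: power_mult_distrib mult.assoc)
  have "(\<Sum>i\<le>k. (-1) ^ i * of_nat (k choose i) * pochhammer x i * pochhammer (y + of_nat i) (k - i))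
      = (\<Sum>i\<le>k. (-1) ^ k * (of_nat (k choose i) * pochhammer x i * pochhammer (1 - y - of_nat k) (k - i)))"
  proof (rule sum.cong[OF refl])
    fix i assume "i \<in> {..k}"
    then have i: "i \<le> k" by simp
    then have "(-1::'a) ^ k = (-1) ^ i * (-1) ^ (k - i)" by (simp flip: power_add)
    then show "(-1) ^ i * of_nat (k choose i) * pochhammer x i * pochhammer (y + of_nat i) (k - i)
      = (-1) ^ k * (of_nat (k choose i) * pochhammer x i * pochhammer (1 - y - of_nat k) (k - i))"
      by (simp add: reflect[OF i])
  qed
  also have "\<dots> = (-1) ^ k * pochhammer (x + (1 - y - of_nat k)) k"
    by (simp only: pochhammer_binomial_sum sum_distrib_left)
  also have "\<dots> = pochhammer (y - x) k"
    using pochhammer_minus'[of "y - x" k] pochhammer_minus[of "y - x - 1 + of_nat k" k]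
    by (simp add: algebra_simps)
  finally show ?thesis .
qed

lemma has_bochner_integral_Beta:
  fixes a b :: real
  assumes "a > -1" "b > -1"
  shows "has_bochner_integral lborel
           (\<lambda>t. indicator {0..1} t * (t powr b * (1 - t) powr a)) (Beta (b + 1) (a + 1))"
proof -
  have "set_integrable lborel {0..1} (\<lambda>t. t powr b * (1 - t) powr a)"
    using integrable_Beta[of "b + 1" "a + 1"] assms by simp
  moreover from set_borel_integral_eq_integral(2)[OF this]
  have "(LINT t:{0..1}|lborel. t powr b * (1 - t) powr a) = Beta (b + 1) (a + 1)"
    using has_integral_Beta_real[of "b + 1" "a + 1"] assms by (simp add: integral_unique)
  ultimately show ?thesis
    by (simp add: has_bochner_integral_iff set_integrable_def set_lebesgue_integral_def)
qed

text \<open>Once the second Pochhammer symbol and the Beta value are written as Gamma quotients,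
  \<open>Gamma (a + real i + 1)\<close> cancels. What remains is a constant times the
  Chu-Vandermonde sum with \<open>x = k + a + b + 1\<close> and \<open>y = a + b + m + 2\<close>, so
  that \<open>y - x = m + 1 - k\<close>.\<close>

lemma jacobi_moment_sum:
  fixes a b :: real
  assumes "a > -1" "b > -1"
  shows "(\<Sum>i\<le>k. (-1) ^ i * (pochhammer (real k + a + b + 1) i * pochhammer (a + real i + 1) (k - i) /
            (fact i * fact (k - i))) * Beta (b + real m + 1) (a + real i + 1))
       = Gamma (a + real k + 1) * Gamma (b + real m + 1) * pochhammer (real m + 1 - real k) k /
           (fact k * Gamma (a + b + real m + real k + 2))"
proof -
  define G where "G = Gamma (a + b + real m + real k + 2)"
  have pos: "a + b + real m + real k + 2 > 0" using assms by linarith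
  then have G0: "G > 0" by (simp add: G_def Gamma_real_pos)
  have "(-1) ^ i * (pochhammer (real k + a + b + 1) i * pochhammer (a + real i + 1) (k - i) /
            (fact i * fact (k - i))) * Beta (b + real m + 1) (a + real i + 1)
     = Gamma (a + real k + 1) * Gamma (b + real m + 1) / (fact k * G) *
       ((-1) ^ i * of_nat (k choose i) * pochhammer (real k + a + b + 1) i *
         pochhammer ((a + b + real m + 2) + of_nat i) (k - i))" if "i \<le> k" for i
  proof -
    have p: "a + real i + 1 > 0" "a + b + real m + 2 + real i > 0" using assms by linarith+
    have 1: "pochhammer (a + real i + 1) (k - i) = Gamma (a + real k + 1) / Gamma (a + real i + 1)"
      using p that by (subst pochhammer_Gamma) (auto simp: of_nat_diff add_ac dest: nonpos_Ints_nonpos)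
    have 2: "pochhammer ((a + b + real m + 2) + of_nat i) (k - i) = G / Gamma (a + b + real m + 2 + real i)"
      using p that by (subst pochhammer_Gamma) (auto simp: G_def of_nat_diff add_ac dest: nonpos_Ints_nonpos)
    have 3: "real (k choose i) = fact k / (fact i * fact (k - i))"
      using that by (rule binomial_fact)
    have 4: "Beta (b + real m + 1) (a + real i + 1) =
        Gamma (b + real m + 1) * Gamma (a + real i + 1) / Gamma (a + b + real m + 2 + real i)"
      by (simp add: Beta_def add_ac)
    have "Gamma (a + real i + 1) > 0" using p by (simp add: Gamma_real_pos)
    then show ?thesis unfolding 1 2 3 4 using G0 by (simp add: field_simps)
  qed
  then have "(\<Sum>i\<le>k. (-1) ^ i * (pochhammer (real k + a + b + 1) i * pochhammer (a + real i + 1) (k - i) /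
            (fact i * fact (k - i))) * Beta (b + real m + 1) (a + real i + 1))
     = Gamma (a + real k + 1) * Gamma (b + real m + 1) / (fact k * G) *
       pochhammer ((a + b + real m + 2) - (real k + a + b + 1)) k"
    unfolding chu_vandermonde[symmetric] sum_distrib_left by (intro sum.cong) auto
  also have "(a + b + real m + 2) - (real k + a + b + 1) = real m + 1 - real k" by simp
  finally show ?thesis by (simp add: G_def)
qed

text \<open>The defining sum is centred at the endpoint \<open>t = 1\<close>. Powers of
  \<open>1 - t\<close> merely raise the exponent \<open>a\<close> of the weight, so each term
  integrates to a Beta value.\<close>

lemma jacobi_poly_reflect:
  "jacobi_poly k a b (2 * t - 1) =
     (\<Sum>i\<le>k. (-1) ^ i * (pochhammer (real k + a + b + 1) i * pochhammer (a + real i + 1) (k - i) /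
            (fact i * fact (k - i))) * (1 - t) ^ i)"
proof -
  have "((2 * t - 1 - 1) / 2) ^ i = (-1) ^ i * (1 - t) ^ i" for i
    by (simp add: field_simps flip: power_mult_distrib)
  then show ?thesis by (simp add: jacobi_poly_def atMost_atLeast0 mult_ac)
qed

lemma jacobi_moment:
  fixes a b :: real
  assumes "a > -1" "b > -1"
  shows "has_bochner_integral lborel
           (\<lambda>t. indicator {0..1} t * (jacobi_poly k a b (2 * t - 1) * t ^ m * (t powr b * (1 - t) powr a)))
           (Gamma (a + real k + 1) * Gamma (b + real m + 1) * pochhammer (real m + 1 - real k) k /
             (fact k * Gamma (a + b + real m + real k + 2)))"
proof -
  define c where "c i = (-1) ^ i * (pochhammer (real k + a + b + 1) i * pochhammer (a + real i + 1) (k - i) /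
            (fact i * fact (k - i)))" for i
  have "has_bochner_integral lborel
     (\<lambda>t. \<Sum>i\<le>k. c i * (indicator {0..1} t * (t powr (b + real m) * (1 - t) powr (a + real i))))
     (\<Sum>i\<le>k. c i * Beta (b + real m + 1) (a + real i + 1))"
    using assms
    by (intro has_bochner_integral_sum has_bochner_integral_mult_right has_bochner_integral_Beta) auto
  also have "(\<Sum>i\<le>k. c i * Beta (b + real m + 1) (a + real i + 1)) =
     Gamma (a + real k + 1) * Gamma (b + real m + 1) * pochhammer (real m + 1 - real k) k /
             (fact k * Gamma (a + b + real m + real k + 2))"
    unfolding c_def by (rule jacobi_moment_sum[OF assms])
  also have "(\<lambda>t. \<Sum>i\<le>k. c i * (indicator {0..1} t * (t powr (b + real m) * (1 - t) powr (a + real i)))) =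
    (\<lambda>t. indicator {0..1} t * (jacobi_poly k a b (2 * t - 1) * t ^ m * (t powr b * (1 - t) powr a)))"
  proof
    fix t :: real
    \<comment> \<open>This covers \<open>s = 0\<close> too: both sides are 0 there, as
      \<open>0 powr x = 0\<close> for every \<open>x\<close>. The integrands therefore agree at the
      endpoints as well.\<close>
    have *: "s powr (x + real n) = s ^ n * s powr x" if "s \<ge> 0" for s x :: real and n
      using that by (cases "s = 0") (auto simp: powr_add powr_realpow)
    show "(\<Sum>i\<le>k. c i * (indicator {0..1} t * (t powr (b + real m) * (1 - t) powr (a + real i)))) =
       indicator {0..1} t * (jacobi_poly k a b (2 * t - 1) * t ^ m * (t powr b * (1 - t) powr a))"
      unfolding jacobi_poly_reflect c_def[symmetric] by (cases "t \<in> {0..1}")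
        (auto simp: * sum_distrib_left sum_distrib_right mult_ac
          intro!: sum.cong)
  qed
  finally show ?thesis .
qed

text \<open>Expanding the \<open>j\<close>-th polynomial in powers of \<open>t\<close> leaves
  moments of the \<open>k\<close>-th one, and those of order below \<open>k\<close> vanish. Since
  \<open>j \<le> k\<close>, only order \<open>k\<close> can contribute, and only when
  \<open>j = k\<close>; the value is then the leading coefficient \<open>c k\<close> times the
  \<open>k\<close>-th moment \<open>L k\<close>.\<close>

lemma jacobi_orthogonality_le:
  fixes a b :: real
  assumes "a > -1" "b > -1" "j \<le> k"
  shows "has_bochner_integral lborel
           (\<lambda>t. indicator {0..1} t * (jacobi_poly k a b (2 * t - 1) * jacobi_poly j a b (2 * t - 1) *
              (t powr b * (1 - t) powr a)))
           (if k = j then Gamma (real k + a + 1) * Gamma (real k + b + 1) / (norm_factor k a b * Gamma (real k + 1))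
            else 0)"
proof -
  define L where "L m = Gamma (a + real k + 1) * Gamma (b + real m + 1) * pochhammer (real m + 1 - real k) k /
             (fact k * Gamma (a + b + real m + real k + 2))" for m
  define c where "c i = pochhammer (real j + a + b + 1) i * pochhammer (a + real i + 1) (j - i) /
            (fact i * fact (j - i))" for i
  define W where "W t = t powr b * (1 - t) powr a" for t
  have L0: "L m = 0" if "m < k" for m
  proof -
    \<comment> \<open>The factor with index \<open>k - m - 1\<close> is zero.\<close>
    have "pochhammer (real m + 1 - real k) k = 0"
      using that by (subst pochhammer_eq_0_iff) (auto intro!: exI[of _ "k - m - 1"] simp: of_nat_diff)
    then show ?thesis by (simp add: L_def)
  qed
  have P: "jacobi_poly j a b (2 * t - 1) =
      (\<Sum>i\<le>j. \<Sum>m\<le>i. c i * (of_nat (i choose m) * (-1) ^ (i - m)) * t ^ m)" for t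
  proof -
    have "((2 * t - 1 - 1) / 2) ^ i = (\<Sum>m\<le>i. of_nat (i choose m) * t ^ m * (-1) ^ (i - m))" for i
    proof -
      have "(2 * t - 1 - 1) / 2 = t + (-1)" by simp
      then show ?thesis by (simp only: binomial_ring)
    qed
    moreover have "jacobi_poly j a b (2 * t - 1) = (\<Sum>i\<le>j. c i * ((2 * t - 1 - 1) / 2) ^ i)"
      by (simp add: jacobi_poly_def atMost_atLeast0 c_def)
    ultimately show ?thesis by (simp add: sum_distrib_left mult_ac)
  qed
  have "has_bochner_integral lborel
     (\<lambda>t. \<Sum>i\<le>j. \<Sum>m\<le>i. c i * (of_nat (i choose m) * (-1) ^ (i - m)) *
        (indicator {0..1} t * (jacobi_poly k a b (2 * t - 1) * t ^ m * W t)))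
     (\<Sum>i\<le>j. \<Sum>m\<le>i. c i * (of_nat (i choose m) * (-1) ^ (i - m)) * L m)"
    unfolding L_def W_def using assms
    by (intro has_bochner_integral_sum has_bochner_integral_mult_right jacobi_moment) auto
  also have "(\<lambda>t. \<Sum>i\<le>j. \<Sum>m\<le>i. c i * (of_nat (i choose m) * (-1) ^ (i - m)) *
        (indicator {0..1} t * (jacobi_poly k a b (2 * t - 1) * t ^ m * W t))) =
     (\<lambda>t. indicator {0..1} t * (jacobi_poly k a b (2 * t - 1) * jacobi_poly j a b (2 * t - 1) * W t))"
  proof
    fix t
    show "(\<Sum>i\<le>j. \<Sum>m\<le>i. c i * (of_nat (i choose m) * (-1) ^ (i - m)) *
        (indicator {0..1} t * (jacobi_poly k a b (2 * t - 1) * t ^ m * W t))) =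
      indicator {0..1} t * (jacobi_poly k a b (2 * t - 1) * jacobi_poly j a b (2 * t - 1) * W t)"
      unfolding P by (simp add: sum_distrib_left sum_distrib_right mult_ac)
  qed
  also have "(\<Sum>i\<le>j. \<Sum>m\<le>i. c i * (of_nat (i choose m) * (-1) ^ (i - m)) * L m) =
     (\<Sum>i\<le>j. if i = k then c i * L i else 0)"
  proof (rule sum.cong[OF refl])
    fix i assume "i \<in> {..j}"
    then have i: "i \<le> k" using assms by simp
    \<comment> \<open>As \<open>m \<le> i \<le> k\<close>, a surviving term has
      \<open>m = i = k\<close>, where the binomial coefficient and the sign are both 1.\<close>
    have "(\<Sum>m\<le>i. c i * (of_nat (i choose m) * (-1) ^ (i - m)) * L m) = (\<Sum>m\<le>i. if m = k then c i * L i else 0)"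
      using i L0 by (intro sum.cong) (auto simp: not_less)
    then show "(\<Sum>m\<le>i. c i * (of_nat (i choose m) * (-1) ^ (i - m)) * L m) = (if i = k then c i * L i else 0)"
      using i by auto
  qed
  also have "\<dots> = (if k = j then c k * L k else 0)" using assms by auto
  also have "(if k = j then c k * L k else 0) =
    (if k = j then Gamma (real k + a + 1) * Gamma (real k + b + 1) / (norm_factor k a b * Gamma (real k + 1)) else 0)"
  proof (rule if_cong[OF refl _ refl])
    assume kj: "k = j"
    have Lk: "L k = Gamma (real k + a + 1) * Gamma (real k + b + 1) / Gamma (2 * real k + a + b + 2)"
      by (simp add: L_def pochhammer_fact[symmetric] add_ac)
    have ck: "c k = pochhammer (real k + a + b + 1) k / fact k"
      using kj by (simp add: c_def)
    show "c k * L k = Gamma (real k + a + 1) * Gamma (real k + b + 1) / (norm_factor k a b * Gamma (real k + 1))"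
    proof (cases "k = 0")
      case True
      then show ?thesis unfolding ck Lk by (simp add: norm_factor_def)
    next
      case False
      \<comment> \<open>Since \<open>a + b > -2\<close>, both arguments are positive once
        \<open>k \<ge> 1\<close>, away from the poles of \<open>Gamma\<close>. For
        \<open>k = 0\<close> the number \<open>a + b + 1\<close> may be zero or negative, hence the
        separate case.\<close>
      then have p: "real k + a + b + 1 > 0" "2 * real k + a + b + 1 > 0" using assms by linarith+
      define q where "q = 2 * real k + a + b + 1"
      have q: "q > 0" using p by (simp add: q_def)
      have "pochhammer (real k + a + b + 1) k = Gamma q / Gamma (real k + a + b + 1)"
        using p by (subst pochhammer_Gamma) (auto simp: q_def add_ac dest: nonpos_Ints_nonpos)
      \<comment> \<open>The functional equation of \<open>Gamma\<close> supplies the factor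
        \<open>2k + a + b + 1\<close> of \<open>norm_factor\<close>.\<close>
      moreover have "Gamma (2 * real k + a + b + 2) = q * Gamma q"
        using q Gamma_plus1[of q] nonpos_Ints_nonpos[of q] by (force simp: q_def add_ac)
      moreover have "Gamma (real k + 1) = fact k" by (simp add: Gamma_fact add_ac)
      moreover have "Gamma q \<noteq> 0" using Gamma_real_pos[OF q] by linarith
      ultimately show ?thesis
        using False unfolding ck Lk norm_factor_def q_def[symmetric] by simp
    qed
  qed
  finally show ?thesis by (simp add: W_def)
qed

lemma jacobi_orthogonality:
  fixes a b :: real
  assumes "a > -1" "b > -1"
  shows "has_bochner_integral lborel
           (\<lambda>t. indicator {0..1} t * (jacobi_poly k a b (2 * t - 1) * jacobi_poly j a b (2 * t - 1) *
              (t powr b * (1 - t) powr a)))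
           (if k = j then Gamma (real k + a + 1) * Gamma (real k + b + 1) / (norm_factor k a b * Gamma (real k + 1))
            else 0)"
proof (cases "j \<le> k")
  case True
  then show ?thesis by (rule jacobi_orthogonality_le[OF assms])
next
  case False
  then show ?thesis using jacobi_orthogonality_le[OF assms, of k j] by (auto simp: mult_ac)
qed

text \<open>This serves the case of different degrees \<open>n\<close> and \<open>m\<close>, where
  the two Jacobi parameters may differ and the value of the radial integral is not computed. The
  polynomials are bounded on [0, 1], so a multiple of the Beta integrand dominates.\<close>

lemma integrable_jacobi_weight:
  fixes a b b' c :: real
  assumes "a > -1" "c > -1"
  shows "integrable lborel
           (\<lambda>t. indicator {0..1} t * (jacobi_poly k a b (2 * t - 1) * jacobi_poly j a b' (2 * t - 1) *
              (t powr c * (1 - t) powr a)))"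
proof -
  let ?P = "\<lambda>t. jacobi_poly k a b (2 * t - 1) * jacobi_poly j a b' (2 * t - 1)"
  have cont: "continuous_on A ?P" for A
    unfolding jacobi_poly_def by (intro continuous_intros) auto
  obtain B where B: "\<And>t. t \<in> {0..1} \<Longrightarrow> \<bar>?P t\<bar> \<le> B"
    using compact_imp_bounded[OF compact_continuous_image[OF cont compact_Icc], of 0 1]
    unfolding bounded_iff real_norm_def by blast
  have "integrable lborel (\<lambda>t. B * (indicator {0..1} t * (t powr c * (1 - t) powr a)))"
    using has_bochner_integral_Beta[OF assms] by (auto simp: has_bochner_integral_iff)
  then show ?thesis
  proof (rule Bochner_Integration.integrable_bound)
    have "?P \<in> borel_measurable borel" by (rule borel_measurable_continuous_onI[OF cont])
    then show "(\<lambda>t. indicator {0..1} t * (?P t * (t powr c * (1 - t) powr a))) \<in> borel_measurable lborel"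
      by measurable
    show "AE t in lborel. norm (indicator {0..1} t * (?P t * (t powr c * (1 - t) powr a)))
        \<le> norm (B * (indicator {0..1} t * (t powr c * (1 - t) powr a)))"
      using order_trans[OF B abs_ge_self] by (auto simp: abs_mult indicator_def intro!: mult_right_mono)
  qed
qed

section \<open>Polar decomposition of Lebesgue measure on the ball\<close>

text \<open>For \<open>c = d\<close>, the law of \<open>norm x powr p\<close> for a uniformly random point of the unit ball.\<close>

definition radial_law :: "real \<Rightarrow> real \<Rightarrow> real measure" where
  "radial_law c p = density lborel (\<lambda>t. ennreal (indicator {0..1} t * (c / p * t powr (c / p - 1))))"

lemma sigma_finite_radial_law: "sigma_finite_measure (radial_law c p)"
  unfolding radial_law_def
  by (subst sigma_finite_measure.sigma_finite_iff_density_finite[OF sigma_finite_lborel]) auto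

text \<open>The density is the derivative of \<open>t powr (c / p)\<close>. Clamping
  \<open>s\<close> to [0, 1] treats all thresholds at once, which allows a comparison of measures on
  half-lines.\<close>

lemma emeasure_radial_law_greaterThan:
  fixes s :: real
  assumes "c > 0" "p > 0"
  defines "s' \<equiv> max 0 (min 1 s)"
  shows "emeasure (radial_law c p) {s<..} = ennreal (1 - s' powr (c / p))"
proof -
  have s': "0 \<le> s'" "s' \<le> 1" by (auto simp: s'_def)
  define q where "q = c / p"
  have q: "q > 0" using assms by (simp add: q_def)
  define f where "f t = q * t powr (q - 1)" for t :: real
  have int: "(f has_integral u powr q) {0..u}" if "u \<ge> 0" for u
    using has_integral_mult_right[OF has_integral_powr_from_0[of "q - 1" u], of q] q that
    by (simp add: f_def[abs_def])
  \<comment> \<open>The density may blow up at 0, so this integral is the difference of two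
    integrals starting at 0.\<close>
  have "(f has_integral (1 - s' powr q)) {s'..1}"
  proof -
    have "f integrable_on {0..1}" using int[of 1] by auto
    then have "f integrable_on {s'..1}"
      using s' by (auto intro: integrable_on_subinterval)
    then obtain y where y: "(f has_integral y) {s'..1}" by auto
    have "(f has_integral (s' powr q + y)) {0..1}"
      using s' by (intro has_integral_combine[OF _ _ int y]) auto
    then have "y = 1 - s' powr q" using int[of 1] by (auto dest: has_integral_unique)
    then show ?thesis using y by simp
  qed
  then have "((\<lambda>t. if t \<in> {s'..1} then f t else 0) has_integral (1 - s' powr q)) UNIV"
    by (simp only: has_integral_restrict_UNIV)
  then have "(\<integral>\<^sup>+t. ennreal (if t \<in> {s'..1} then f t else 0) \<partial>lborel) = ennreal (1 - s' powr q)"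
  proof (rule nn_integral_has_integral_lborel[rotated 2])
    have "f \<in> borel_measurable borel" unfolding f_def by measurable
    then show "(\<lambda>t. if t \<in> {s'..1} then f t else 0) \<in> borel_measurable borel" by measurable
  qed (use q in \<open>auto simp: f_def\<close>)
  moreover have "emeasure (radial_law c p) {s<..} =
      (\<integral>\<^sup>+t. ennreal (indicator {0..1} t * f t) * indicator {s<..} t \<partial>lborel)"
    unfolding radial_law_def q_def[symmetric] f_def by (rule emeasure_density) auto
  \<comment> \<open>The two integrands can differ only at \<open>t = s'\<close>.\<close>
  moreover have "\<dots> = (\<integral>\<^sup>+t. ennreal (if t \<in> {s'..1} then f t else 0) \<partial>lborel)"
    using AE_lborel_singleton[of s']
    by (intro nn_integral_cong_AE) (auto elim!: eventually_mono simp: indicator_def s'_def)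
  ultimately show ?thesis by (simp add: q_def)
qed

lemma emeasure_lborel_scaleR_image:
  fixes A :: "'a::euclidean_space set"
  assumes "A \<in> sets borel" "r \<noteq> 0"
  shows "emeasure lborel ((*\<^sub>R) r ` A) = ennreal (\<bar>r\<bar> ^ DIM('a)) * emeasure lborel A"
proof -
  have "(*\<^sub>R) r ` A = (*\<^sub>R) (inverse r) -` A \<inter> space borel"
    using assms(2) by (auto simp: image_iff intro!: bexI[of _ "inverse r *\<^sub>R x" for x])
  moreover have "(*\<^sub>R) (inverse r) -` A \<inter> space borel \<in> sets borel"
    by (rule measurable_sets[OF _ assms(1)]) simp
  ultimately have "(*\<^sub>R) r ` A \<in> sets borel" by simp
  then show ?thesis
    using emeasure_lebesgue_affine[of r 0 A] assms by (simp add: ennreal_power)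
qed

lemma borel_measurable_sgn [measurable]: "(sgn :: 'a::euclidean_space \<Rightarrow> 'a) \<in> borel_measurable borel"
  unfolding sgn_div_norm by measurable

text \<open>Without the origin, \<open>sgn\<close> maps into the unit sphere; only a null set is
  lost.\<close>

abbreviation punctured_ball :: "'a::euclidean_space measure" where
  "punctured_ball \<equiv> restrict_space lborel (cball 0 1 - {0})"

abbreviation borel_sphere :: "'a::euclidean_space measure" where
  "borel_sphere \<equiv> restrict_space borel (sphere 0 1)"

lemma finite_measure_punctured_ball: "finite_measure (punctured_ball :: 'a::euclidean_space measure)"
proof (rule finite_measureI)
  have "emeasure lborel (cball 0 1 - {0} :: 'a set) \<le> emeasure lborel (cball 0 1 :: 'a set)"
    by (intro emeasure_mono) auto
  also have "\<dots> < \<infinity>" by (rule emeasure_compact_finite) simp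
  finally show "emeasure (punctured_ball :: 'a measure) (space punctured_ball) \<noteq> \<infinity>"
    by (simp add: space_restrict_space emeasure_restrict_space)
qed

lemma measurable_sgn_sphere:
  "sgn \<in> (punctured_ball :: 'a::euclidean_space measure) \<rightarrow>\<^sub>M borel_sphere"
proof (rule measurable_restrict_space2)
  show "sgn \<in> space punctured_ball \<rightarrow> sphere 0 1"
    by (auto simp: norm_sgn space_restrict_space)
  show "(sgn :: 'a \<Rightarrow> 'a) \<in> borel_measurable punctured_ball"
    by (simp add: measurable_restrict_space1)
qed

lemma sigma_finite_distr_sgn:
  "sigma_finite_measure (distr (punctured_ball :: 'a::euclidean_space measure) borel_sphere sgn)"
  by (rule finite_measure.axioms(1))
    (rule finite_measure.finite_measure_distr[OF finite_measure_punctured_ball measurable_sgn_sphere])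

text \<open>The cone of radius \<open>r > 0\<close> is the dilation by \<open>r\<close> of the one
  of radius 1. For \<open>r = 0\<close> the cone is empty and the factor is 0 because the dimension
  is positive.\<close>

lemma emeasure_cone_scale:
  fixes B :: "'a::euclidean_space set"
  assumes B: "B \<in> sets borel" "B \<subseteq> sphere 0 1" and r: "0 \<le> r"
  shows "emeasure lborel {x. x \<noteq> 0 \<and> norm x \<le> r \<and> sgn x \<in> B} =
    ennreal (r ^ DIM('a)) * emeasure lborel {x. x \<noteq> 0 \<and> norm x \<le> 1 \<and> sgn x \<in> B}"
proof (cases "r = 0")
  case True
  then have empty: "{x. x \<noteq> 0 \<and> norm x \<le> r \<and> sgn x \<in> B} = {}" by auto
  show ?thesis unfolding empty using True by (simp add: zero_power)
next
  case False
  with r have r: "r > 0" by simp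
  have eq: "{x. x \<noteq> 0 \<and> norm x \<le> r \<and> sgn x \<in> B} = (*\<^sub>R) r ` {x. x \<noteq> 0 \<and> norm x \<le> 1 \<and> sgn x \<in> B}"
  proof (intro equalityI subsetI)
    fix x assume "x \<in> {x. x \<noteq> 0 \<and> norm x \<le> r \<and> sgn x \<in> B}"
    then show "x \<in> (*\<^sub>R) r ` {x. x \<noteq> 0 \<and> norm x \<le> 1 \<and> sgn x \<in> B}"
      using r by (intro image_eqI[of _ _ "inverse r *\<^sub>R x"]) (auto simp: sgn_scaleR field_simps)
  qed (use r in \<open>auto simp: sgn_scaleR mult_le_cancel_left1\<close>)
  have "{x \<in> space borel. x \<noteq> 0 \<and> norm x \<le> 1 \<and> sgn x \<in> B} \<in> sets borel"
    using B(1) by measurable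
  then have "{x. x \<noteq> 0 \<and> norm x \<le> 1 \<and> sgn x \<in> B} \<in> sets borel" by simp
  then show ?thesis unfolding eq using r by (subst emeasure_lborel_scaleR_image) auto
qed

text \<open>It suffices to compare rectangles \<open>A \<times> B\<close>. For fixed
  \<open>B\<close>, both sides are finite measures in \<open>A\<close>, determined by half-lines; a
  half-line corresponds to the cone over \<open>B\<close> minus a smaller cone, whose volume is
  known by scaling.\<close>

lemma polar_decomposition:
  fixes p :: real
  assumes p: "p > 0"
  shows "distr (punctured_ball :: 'a::euclidean_space measure) (borel \<Otimes>\<^sub>M borel_sphere) (\<lambda>x. (norm x powr p, sgn x))
    = radial_law DIM('a) p \<Otimes>\<^sub>M distr punctured_ball borel_sphere sgn"
proof (rule pair_measure_eqI[symmetric])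
  let ?R = "punctured_ball :: 'a measure"
  let ?N = "radial_law DIM('a) p"
  let ?S = "distr ?R borel_sphere sgn"
  note [measurable] = measurable_sgn_sphere
  have norm_meas[measurable]: "(\<lambda>x. norm x powr p) \<in> borel_measurable ?R"
    by (rule measurable_restrict_space1) simp
  show "sigma_finite_measure ?S" by (rule sigma_finite_distr_sgn)
  show "sigma_finite_measure ?N" by (rule sigma_finite_radial_law)
  show "sets (?N \<Otimes>\<^sub>M ?S) = sets (distr ?R (borel \<Otimes>\<^sub>M borel_sphere) (\<lambda>x. (norm x powr p, sgn x)))"
    unfolding sets_distr by (intro sets_pair_measure_cong) (simp_all add: radial_law_def)
  show "emeasure ?N A * emeasure ?S B = emeasure (distr ?R (borel \<Otimes>\<^sub>M borel_sphere) (\<lambda>x. (norm x powr p, sgn x))) (A \<times> B)"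
    if A: "A \<in> sets ?N" and B: "B \<in> sets ?S" for A B
  proof -
    have A': "A \<in> sets borel" using A by (simp add: radial_law_def)
    have B': "B \<in> sets borel" "B \<subseteq> sphere 0 1" using B by (auto simp: sets_restrict_space_iff)
    define K where "K = {x::'a. x \<noteq> 0 \<and> norm x \<le> 1 \<and> sgn x \<in> B}"
    have K: "K \<in> sets borel"
    proof -
      have "{x \<in> space borel. x \<noteq> (0::'a) \<and> norm x \<le> 1 \<and> sgn x \<in> B} \<in> sets borel"
        using B'(1) by measurable
      then show ?thesis by (simp add: K_def)
    qed
    have "emeasure lborel K \<le> emeasure lborel (cball 0 1 - {0} :: 'a set)"
      by (intro emeasure_mono) (auto simp: K_def)
    with finite_measure.emeasure_finite[OF finite_measure_punctured_ball, of "cball 0 1 - {0} :: 'a set"]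
    obtain k where k: "emeasure lborel K = ennreal k" "k \<ge> 0"
      by (cases "emeasure lborel K") (auto simp: top_unique emeasure_restrict_space)
    \<comment> \<open>\<open>K\<close> is the cone over \<open>B\<close>, and its volume is the mass
      that the angular measure gives to \<open>B\<close>. The rectangle identity for all
      \<open>A\<close> is thus an equality of two measures on the line.\<close>
    have "scale_measure (emeasure lborel K) ?N = distr (restrict_space lborel K) borel (\<lambda>x. norm x powr p)"
    proof (rule measure_eqI_lessThan)
      show "sets (scale_measure (emeasure lborel K) ?N) = sets borel" by (simp add: radial_law_def)
      fix s :: real
      define s' where "s' = max 0 (min 1 s)"
      have s': "0 \<le> s'" "s' \<le> 1" by (auto simp: s'_def)
      have N: "emeasure ?N {s<..} = ennreal (1 - s' powr (real DIM('a) / p))"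
        unfolding s'_def using p by (intro emeasure_radial_law_greaterThan) auto
      then show "emeasure (scale_measure (emeasure lborel K) ?N) {s<..} < \<infinity>"
        by (simp add: k ennreal_mult[symmetric] ennreal_mult_less_top)
      \<comment> \<open>The radius at which \<open>norm x powr p\<close> reaches the clamped
        threshold.\<close>
      define r where "r = s' powr (1 / p)"
      have r: "0 \<le> r" "r \<le> 1" using s' p by (auto simp: r_def powr_le1)
      have rp: "r powr p = s'" using s' p by (simp add: r_def powr_powr)
      have rd: "r ^ DIM('a) = s' powr (real DIM('a) / p)"
        using s' p by (cases "s' = 0") (simp_all add: r_def powr_powr flip: powr_realpow)
      let ?K = "{x::'a. x \<noteq> 0 \<and> norm x \<le> r \<and> sgn x \<in> B}"
      \<comment> \<open>Replacing \<open>s\<close> by \<open>s'\<close> is harmless because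
        \<open>norm x powr p\<close> lies in (0, 1] on \<open>K\<close>.\<close>
      have less: "s < norm x powr p \<longleftrightarrow> \<not> norm x \<le> r" if "x \<in> K" for x
      proof -
        have x: "0 < norm x powr p" "norm x powr p \<le> 1" "norm x > 0"
          using that p by (auto simp: K_def powr_le1)
        have "norm x \<le> r \<longleftrightarrow> norm x powr p \<le> r powr p"
          using r p x(3) by (smt (verit) powr_less_mono2 powr_mono2)
        then show ?thesis using x by (auto simp: rp s'_def)
      qed
      have "emeasure (distr (restrict_space lborel K) borel (\<lambda>x. norm x powr p)) {s<..}
          = emeasure lborel (K - ?K)"
      proof -
        have "(\<lambda>x. norm x powr p) -` {s<..} \<inter> space (restrict_space lborel K) = K - ?K"
          using less by (auto simp: space_restrict_space K_def)
        then show ?thesis using K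
          by (subst emeasure_distr) (auto simp: emeasure_restrict_space intro!: measurable_restrict_space1)
      qed
      also have "\<dots> = emeasure lborel K - emeasure lborel ?K"
      proof (rule emeasure_Diff)
        have "{x \<in> space borel. x \<noteq> (0::'a) \<and> norm x \<le> r \<and> sgn x \<in> B} \<in> sets borel"
          using B'(1) by measurable
        then show "?K \<in> sets lborel" by simp
        have cone: "emeasure lborel ?K = ennreal (r ^ DIM('a)) * emeasure lborel K"
          unfolding K_def by (rule emeasure_cone_scale[OF B' r(1)])
        then show "emeasure lborel ?K \<noteq> \<infinity>"
          by (simp add: k ennreal_mult_eq_top_iff)
      qed (use K r in \<open>auto simp: K_def\<close>)
      also have "\<dots> = ennreal (k - s' powr (real DIM('a) / p) * k)"
        using emeasure_cone_scale[OF B' r(1)] s' k(2) unfolding K_def[symmetric] k rd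
        by (simp add: ennreal_minus flip: ennreal_mult)
      finally show "emeasure (scale_measure (emeasure lborel K) ?N) {s<..} =
        emeasure (distr (restrict_space lborel K) borel (\<lambda>x. norm x powr p)) {s<..}"
        using k(2) s' p by (simp add: N k powr_le1 algebra_simps flip: ennreal_mult)
    qed simp
    from arg_cong[OF this, of "\<lambda>M. emeasure M A"]
    have "emeasure lborel K * emeasure ?N A =
        emeasure (restrict_space lborel K) ((\<lambda>x. norm x powr p) -` A \<inter> K)"
      using A' by (subst (asm) emeasure_distr)
        (auto intro!: measurable_restrict_space1 simp: space_restrict_space)
    also have "\<dots> = emeasure lborel ((\<lambda>x. norm x powr p) -` A \<inter> K)"
      using K by (intro emeasure_restrict_space) auto
    also have "(\<lambda>x. norm x powr p) -` A \<inter> K = (\<lambda>x. (norm x powr p, sgn x)) -` (A \<times> B) \<inter> space ?R"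
      by (auto simp: K_def space_restrict_space)
    also have "emeasure lborel \<dots> = emeasure ?R ((\<lambda>x. (norm x powr p, sgn x)) -` (A \<times> B) \<inter> space ?R)"
      by (rule emeasure_restrict_space[symmetric]) (auto simp: space_restrict_space)
    also have "\<dots> = emeasure (distr ?R (borel \<Otimes>\<^sub>M borel_sphere) (\<lambda>x. (norm x powr p, sgn x))) (A \<times> B)"
      using A' B by (intro emeasure_distr[symmetric]) auto
    also have "emeasure lborel K = emeasure ?S B"
    proof -
      have "sgn -` B \<inter> space ?R = K" by (auto simp: K_def space_restrict_space)
      moreover have "K \<subseteq> cball 0 1 - {0}" by (auto simp: K_def)
      ultimately show ?thesis using B
        by (simp add: emeasure_distr[OF measurable_sgn_sphere] emeasure_restrict_space)
    qed
    finally show ?thesis by (simp add: mult.commute)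
  qed
qed

section \<open>Integration in polar coordinates\<close>

lemma has_bochner_integral_pair_mult:
  fixes f :: "'a \<Rightarrow> real" and g :: "'b \<Rightarrow> real"
  assumes "sigma_finite_measure M" "sigma_finite_measure N"
    and f: "has_bochner_integral M f I" and g: "has_bochner_integral N g J"
  shows "has_bochner_integral (M \<Otimes>\<^sub>M N) (\<lambda>x. f (fst x) * g (snd x)) (I * J)"
proof -
  interpret M: sigma_finite_measure M by fact
  interpret N: sigma_finite_measure N by fact
  interpret pair_sigma_finite M N ..
  have [measurable]: "f \<in> borel_measurable M" "g \<in> borel_measurable N"
    and int: "integrable M f" "integrable N g" "integral\<^sup>L M f = I" "integral\<^sup>L N g = J"
    using f g by (auto simp: has_bochner_integral_iff)
  have "integrable (M \<Otimes>\<^sub>M N) (\<lambda>x. f (fst x) * g (snd x))"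
    by (rule Fubini_integrable) (use int in \<open>auto simp: abs_mult\<close>)
  moreover from integral_fst'[OF this] have "(\<integral>x. f (fst x) * g (snd x) \<partial>(M \<Otimes>\<^sub>M N)) = I * J"
    using int by simp
  ultimately show ?thesis by (simp add: has_bochner_integral_iff)
qed

lemma has_bochner_integral_density_iff:
  fixes f g :: "'a \<Rightarrow> real"
  assumes "f \<in> borel_measurable M" "g \<in> borel_measurable M" "\<And>x. 0 \<le> g x"
  shows "has_bochner_integral (density M (\<lambda>x. ennreal (g x))) f I \<longleftrightarrow>
         has_bochner_integral M (\<lambda>x. g x * f x) I"
  using assms by (simp add: has_bochner_integral_iff integrable_real_density integral_real_density)

text \<open>As a constant density, the dimension factor can be moved into the integrand by
  \<open>has_bochner_integral_density_iff\<close>.\<close>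

lemma surface_measure_eq_density:
  "(surface_measure :: (real^'d::finite) measure) =
     density (distr punctured_ball borel_sphere sgn) (\<lambda>_. ennreal (real CARD('d)))"
  by (rule measure_eqI)
    (auto simp: surface_measure_def emeasure_density_const ennreal_of_nat_eq_real_of_nat)

text \<open>Polar decomposition and Fubini give the product of a radial and an angular integral. The
  factor \<open>d / p\<close> of the radial density meets the normalisation \<open>1 / d\<close> of
  the angular measure, which leaves \<open>1 / p\<close>.\<close>

lemma has_bochner_integral_polar:
  fixes F :: "real \<Rightarrow> real" and g :: "real^'d::finite \<Rightarrow> real"
  assumes p: "p > 0"
    and [measurable]: "F \<in> borel_measurable borel" "g \<in> borel_measurable borel"
    and I: "has_bochner_integral lborel
              (\<lambda>t. indicator {0..1} t * (t powr (real CARD('d) / p - 1) * F t)) I"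
    and J: "has_bochner_integral surface_measure g J"
  shows "has_bochner_integral lborel
           (\<lambda>x. indicator (cball 0 1) x * (F (norm x powr p) * g (sgn x))) (I * J / p)"
proof -
  let ?d = "real CARD('d)"
  let ?R = "punctured_ball :: (real^'d) measure"
  let ?S = "distr ?R borel_sphere sgn"
  let ?N = "radial_law ?d p"
  let ?h = "\<lambda>x::real^'d. (norm x powr p, sgn x)"
  note [measurable] = measurable_sgn_sphere
  have [measurable]: "(\<lambda>x. norm x powr p) \<in> borel_measurable ?R"
    by (rule measurable_restrict_space1) simp
  have [measurable]: "g \<in> borel_measurable borel_sphere"
    by (rule measurable_restrict_space1) simp
  have "has_bochner_integral ?S (\<lambda>u. ?d * g u) J"
    using J unfolding surface_measure_eq_density by (subst (asm) has_bochner_integral_density_iff) auto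
  from has_bochner_integral_mult_right[OF this, of "1 / ?d"]
  have g: "has_bochner_integral ?S g (J / ?d)" by simp
  have F: "has_bochner_integral ?N F (?d / p * I)"
    unfolding radial_law_def
    by (subst has_bochner_integral_density_iff)
      (use p has_bochner_integral_mult_right[OF I, of "?d / p"] in \<open>auto simp: mult_ac\<close>)
  have "has_bochner_integral (?N \<Otimes>\<^sub>M ?S) (\<lambda>z. F (fst z) * g (snd z)) (?d / p * I * (J / ?d))"
  proof (rule has_bochner_integral_pair_mult[OF _ _ F g])
    show "sigma_finite_measure ?N" by (rule sigma_finite_radial_law)
    show "sigma_finite_measure ?S" by (rule sigma_finite_distr_sgn)
  qed
  then have "has_bochner_integral (distr ?R (borel \<Otimes>\<^sub>M borel_sphere) ?h) (\<lambda>z. F (fst z) * g (snd z)) (I * J / p)"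
    using polar_decomposition[OF p, where 'a = "real^'d"] by (simp add: mult_ac)
  then have "has_bochner_integral ?R (\<lambda>x. F (norm x powr p) * g (sgn x)) (I * J / p)"
    by (simp add: has_bochner_integral_iff integrable_distr_eq integral_distr)
  then have "has_bochner_integral lborel
      (\<lambda>x. indicator (cball 0 1 - {0}) x * (F (norm x powr p) * g (sgn x))) (I * J / p)"
    by (simp add: has_bochner_integral_iff integrable_restrict_space integral_restrict_space)
  \<comment> \<open>The origin is restored, being a null set.\<close>
  also have "?this \<longleftrightarrow> ?thesis"
  proof (rule has_bochner_integral_cong_AE)
    show "AE x in lborel. indicator (cball 0 1 - {0}) x * (F (norm x powr p) * g (sgn x)) =
        indicator (cball 0 1) x * (F (norm x powr p) * g (sgn x))"
      using AE_lborel_singleton[of 0] by (auto elim!: eventually_mono simp: indicator_def)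
    have meas: "(\<lambda>x. indicator A x * (F (norm x powr p) * g (sgn x))) \<in> borel_measurable lborel"
      if [measurable]: "A \<in> sets borel" for A
      by measurable
    show "(\<lambda>x. indicator (cball 0 1 - {0}) x * (F (norm x powr p) * g (sgn x))) \<in> borel_measurable lborel"
      "(\<lambda>x. indicator (cball 0 1) x * (F (norm x powr p) * g (sgn x))) \<in> borel_measurable lborel"
      by (intro meas; simp)+
  qed
  finally show ?thesis .
qed

section \<open>Spherical harmonics as integrable functions on the sphere\<close>

text \<open>The continuous functions form a subspace that contains all monomials, hence their
  span.\<close>

lemma continuous_on_homogeneous_polys:
  assumes "f \<in> homogeneous_polys n"
  shows "continuous_on A f"
proof -
  have "homogeneous_polys n \<subseteq> {f :: real^'a \<Rightarrow> real. continuous_on A f}"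
    unfolding homogeneous_polys_def
  proof (rule real_fun.span_minimal)
    show "real_fun.subspace {f :: real^'a \<Rightarrow> real. continuous_on A f}"
      by (auto simp: real_fun.subspace_def zero_fun_def plus_fun_def intro!: continuous_intros)
  qed (auto intro!: continuous_intros)
  then show ?thesis using assms by auto
qed

lemma finite_measure_surface_measure: "finite_measure (surface_measure :: (real^'d::finite) measure)"
proof (rule finite_measureI)
  let ?S = "distr (punctured_ball :: (real^'d) measure) borel_sphere sgn"
  interpret finite_measure ?S
    by (rule finite_measure.finite_measure_distr[OF finite_measure_punctured_ball measurable_sgn_sphere])
  show "emeasure (surface_measure :: (real^'d) measure) (space surface_measure) \<noteq> \<infinity>"
    by (simp add: surface_measure_def ennreal_mult_eq_top_iff)
qed

text \<open>A continuous function is bounded on the compact sphere, and the surface measure is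
  finite. Orthonormality alone would not give integrability, since the Bochner integral of a
  non-integrable function is 0 by default.\<close>

lemma integrable_surface_measure_continuous:
  fixes f :: "real^'d::finite \<Rightarrow> real"
  assumes "continuous_on UNIV f"
  shows "integrable surface_measure f"
proof -
  interpret finite_measure "surface_measure :: (real^'d) measure"
    by (rule finite_measure_surface_measure)
  have space: "space surface_measure = (sphere 0 1 :: (real^'d) set)"
    by (simp add: surface_measure_def space_scale_measure space_restrict_space)
  have "compact (f ` sphere 0 1)"
    using continuous_on_subset[OF assms] by (intro compact_continuous_image) auto
  then obtain B where B: "\<And>x. x \<in> sphere 0 1 \<Longrightarrow> norm (f x) \<le> B"
    unfolding bounded_iff by (meson compact_imp_bounded bounded_iff image_eqI)
  have "f \<in> borel_measurable borel_sphere"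
    using assms by (intro measurable_restrict_space1 borel_measurable_continuous_onI)
  then have "f \<in> borel_measurable surface_measure"
    by (simp add: surface_measure_def)
  then show ?thesis
    using B by (intro integrable_const_bound[of _ B]) (auto simp: space)
qed

section \<open>Orthogonality of the Muntz ball polynomials\<close>

text \<open>The three exponents of \<open>norm x\<close> add up, with the \<open>\<mu>\<close> terms
  cancelling, to \<open>2 * \<theta>\<close> times the exponent of \<open>t\<close>. The integrand
  thus splits into a function of \<open>t\<close> and a function of the direction.\<close>

lemma muntz_ball_poly_mult_weight:
  fixes x :: "real^'d::finite"
  assumes "\<theta> > 0"
  shows "muntz_ball_poly Y \<alpha> \<mu> \<theta> \<beta> k l n x * muntz_ball_poly Y \<alpha> \<mu> \<theta> \<beta> j i m x * ball_weight \<alpha> \<mu> \<theta> x =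
    (let t = norm x powr (2 * \<theta>) in
      jacobi_poly k \<alpha> (\<beta> n) (2 * t - 1) * jacobi_poly j \<alpha> (\<beta> m) (2 * t - 1) *
      (t powr ((\<beta> n + \<beta> m) / 2 + 1 - real CARD('d) / (2 * \<theta>)) * (1 - t) powr \<alpha>)) *
    (Y l n (sgn x) * Y i m (sgn x))"
proof -
  define d where "d = real CARD('d)"
  have "2 * \<theta> * ((\<beta> n + \<beta> m) / 2 + 1 - d / (2 * \<theta>)) =
      (\<theta> * \<beta> n + 1 - d / 2 - \<mu>) + (\<theta> * \<beta> m + 1 - d / 2 - \<mu>) + (2 * \<theta> + 2 * \<mu> - 2)"
    using assms by (simp add: field_simps)
  then have "(norm x powr (2 * \<theta>)) powr ((\<beta> n + \<beta> m) / 2 + 1 - d / (2 * \<theta>)) =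
      norm x powr (\<theta> * \<beta> n + 1 - d / 2 - \<mu>) * norm x powr (\<theta> * \<beta> m + 1 - d / 2 - \<mu>) *
      norm x powr (2 * \<theta> + 2 * \<mu> - 2)"
    by (simp only: powr_powr powr_add)
  then show ?thesis
    by (simp add: muntz_ball_poly_def ball_weight_def Let_def mult_ac flip: d_def)
qed

theorem theorem1:
  fixes Y :: "nat \<Rightarrow> nat \<Rightarrow> real^'d::finite \<Rightarrow> real"
    and \<alpha> \<mu> \<theta> :: real and \<beta> :: "nat \<Rightarrow> real"
    and k j l n i m :: nat
  assumes "orthonormal_harmonic_basis Y"
    and "\<alpha> > -1" and "\<mu> > -1/2" and "\<theta> > 0"
    and "incseq \<beta>" and "\<beta> 0 > -1"
    and "(l, n) \<in> harmonic_index TYPE('d)" and "(i, m) \<in> harmonic_index TYPE('d)"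
  shows "set_integrable lborel (cball 0 1)
           (\<lambda>x. muntz_ball_poly Y \<alpha> \<mu> \<theta> \<beta> k l n x * muntz_ball_poly Y \<alpha> \<mu> \<theta> \<beta> j i m x *
                ball_weight \<alpha> \<mu> \<theta> x) \<and>
         (LINT x:cball 0 1|lborel.
            muntz_ball_poly Y \<alpha> \<mu> \<theta> \<beta> k l n x * muntz_ball_poly Y \<alpha> \<mu> \<theta> \<beta> j i m x *
            ball_weight \<alpha> \<mu> \<theta> x) =
         (if k = j \<and> n = m \<and> l = i
          then Gamma (real k + \<alpha> + 1) * Gamma (real k + \<beta> n + 1) /
               (2 * \<theta> * norm_factor k \<alpha> (\<beta> n) * Gamma (real k + 1))
          else 0)"
proof -
  note \<alpha> = assms(2) and \<theta> = assms(4)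
  define J where "J = (if n = m \<and> l = i then 1 else 0 :: real)"
  define I where "I = (if k = j then Gamma (real k + \<alpha> + 1) * Gamma (real k + \<beta> n + 1) /
      (norm_factor k \<alpha> (\<beta> n) * Gamma (real k + 1)) else 0)"
  have \<beta>: "\<beta> n > -1" for n
    using assms(5,6) by (meson incseq_def le0 order_less_le_trans)
  have Y: "continuous_on UNIV (Y l n)" if "(l, n) \<in> harmonic_index TYPE('d)" for l n
  proof -
    have "Y l n \<in> real_fun.span ((\<lambda>l. Y l n) ` {1..harmonic_dim TYPE('d) n})"
      using that by (intro real_fun.span_base) (auto simp: harmonic_index_def)
    also have "\<dots> = harmonic_polys n"
      using assms(1) by (simp add: orthonormal_harmonic_basis_def Let_def)
    finally show ?thesis
      by (auto simp: harmonic_polys_def intro: continuous_on_homogeneous_polys)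
  qed
  let ?g = "\<lambda>u. Y l n u * Y i m u"
  have cont: "continuous_on UNIV ?g"
    using Y assms(7,8) by (intro continuous_on_mult) auto
  have "(LINT x|surface_measure. ?g x) = J"
    using assms(1,7,8) unfolding orthonormal_harmonic_basis_def J_def by fast
  then have J: "has_bochner_integral surface_measure ?g J"
    using integrable_surface_measure_continuous[OF cont] by (simp add: has_bochner_integral_iff)

  define P where "P t = jacobi_poly k \<alpha> (\<beta> n) (2 * t - 1) * jacobi_poly j \<alpha> (\<beta> m) (2 * t - 1)" for t
  \<comment> \<open>This exponent is \<open>(\<beta> n + \<beta> m) / 2\<close> minus the exponent
    \<open>d / (2 * \<theta>) - 1\<close> of the radial density.\<close>
  define e where "e = (\<beta> n + \<beta> m) / 2 + 1 - real CARD('d) / (2 * \<theta>)"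
  define F where "F t = P t * (t powr e * (1 - t) powr \<alpha>)" for t
  have [measurable]: "P \<in> borel_measurable borel"
    unfolding P_def jacobi_poly_def by measurable
  have F: "t powr (real CARD('d) / (2 * \<theta>) - 1) * F t = P t * (t powr ((\<beta> n + \<beta> m) / 2) * (1 - t) powr \<alpha>)"
    for t by (simp add: F_def e_def mult_ac flip: powr_add)
  have "integrable lborel (\<lambda>t. indicator {0..1} t * (P t * (t powr ((\<beta> n + \<beta> m) / 2) * (1 - t) powr \<alpha>)))"
    unfolding P_def using \<alpha> \<beta>[of n] \<beta>[of m] by (intro integrable_jacobi_weight) auto
  \<comment> \<open>For \<open>n = m\<close> the exponent \<open>(\<beta> n + \<beta> m) / 2\<close>
    equals \<open>\<beta> n\<close>, so this is the Jacobi weight of both polynomials.\<close>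
  moreover have "has_bochner_integral lborel
      (\<lambda>t. indicator {0..1} t * (P t * (t powr ((\<beta> n + \<beta> m) / 2) * (1 - t) powr \<alpha>))) I" if "n = m"
    using jacobi_orthogonality[OF \<alpha> \<beta>[of n], of k j] that by (simp add: P_def I_def)
  \<comment> \<open>For \<open>n \<noteq> m\<close> the radial integral \<open>I'\<close> may have
    any value, because the angular factor \<open>J\<close> is then 0.\<close>
  ultimately obtain I' where I': "n = m \<longrightarrow> I' = I"
    and "has_bochner_integral lborel
      (\<lambda>t. indicator {0..1} t * (P t * (t powr ((\<beta> n + \<beta> m) / 2) * (1 - t) powr \<alpha>))) I'"
    by (cases "n = m") (auto simp: has_bochner_integral_iff)
  then have "has_bochner_integral lborel
     (\<lambda>x. indicator (cball 0 1) x * (F (norm x powr (2 * \<theta>)) * ?g (sgn x))) (I' * J / (2 * \<theta>))"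
    using J \<theta> borel_measurable_continuous_onI[OF cont] unfolding F[symmetric]
    by (intro has_bochner_integral_polar) (auto simp: F_def[abs_def])
  moreover have "F (norm x powr (2 * \<theta>)) * ?g (sgn x) =
     muntz_ball_poly Y \<alpha> \<mu> \<theta> \<beta> k l n x * muntz_ball_poly Y \<alpha> \<mu> \<theta> \<beta> j i m x * ball_weight \<alpha> \<mu> \<theta> x" for x
    unfolding muntz_ball_poly_mult_weight[OF \<theta>] F_def P_def e_def Let_def ..
  ultimately have "has_bochner_integral lborel
     (\<lambda>x. indicator (cball 0 1) x * (muntz_ball_poly Y \<alpha> \<mu> \<theta> \<beta> k l n x *
        muntz_ball_poly Y \<alpha> \<mu> \<theta> \<beta> j i m x * ball_weight \<alpha> \<mu> \<theta> x)) (I' * J / (2 * \<theta>))"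
    by simp
  moreover have "I' * J / (2 * \<theta>) = (if k = j \<and> n = m \<and> l = i
          then Gamma (real k + \<alpha> + 1) * Gamma (real k + \<beta> n + 1) /
               (2 * \<theta> * norm_factor k \<alpha> (\<beta> n) * Gamma (real k + 1))
          else 0)"
    using I' by (auto simp: I_def J_def)
  ultimately show ?thesis
    by (simp add: has_bochner_integral_iff set_integrable_def set_lebesgue_integral_def)
qed

end
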